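(* Let $B=\frac{d}{dt}+\frac{2\pi i a}{b}t$. Then $B$ commutes with $A$-translations: for every $x\in\mathbb{R}$ and every $f\in S(\mathbb{R})$, $BT_x^Af=T_x^ABf$.
   Context: $a,b$ are real numbers with $b\neq0$ (part of the parameter set $A=\{a,b,c,d,p,q\}$ with $ad-bc=1$). $S(\mathbb{R})$ is the Schwartz space. $(Bf)(t)=f'(t)+\frac{2\pi i a}{b}tf(t)$, and the $A$-translation is $T_x^Af(t)=e^{-\frac{2\pi i a}{b}x(t-x)}f(t-x)$. *)

theory Defs
  imports "HOL-Analysis.Analysis"
begin

record param_set =
  par_a :: real
  par_b :: real
  par_c :: real
  par_d :: real
  par_p :: real
  par_q :: real

definition admissible :: "param_set \<Rightarrow> bool" where
  "admissible A \<longleftrightarrow> par_a A * par_d A - par_b A * par_c A = 1 \<and> par_b A \<noteq> 0"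

definition vderiv :: "(real \<Rightarrow> complex) \<Rightarrow> real \<Rightarrow> complex" where
  "vderiv f = (\<lambda>t. vector_derivative f (at t))"

text \<open>The derivative is total, returning an unspecified value where it does not exist,
  so smoothness is a separate clause below.\<close>

definition schwartz_space :: "(real \<Rightarrow> complex) set" where
  "schwartz_space =
     {f. (\<forall>n t. (vderiv ^^ n) f differentiable (at t)) \<and>
         (\<forall>m n. \<exists>C. \<forall>t. \<bar>t\<bar> ^ m * norm ((vderiv ^^ n) f t) \<le> C)}"

definition B_op :: "param_set \<Rightarrow> (real \<Rightarrow> complex) \<Rightarrow> real \<Rightarrow> complex" where
  "B_op A f =
     (\<lambda>t. vderiv f t + (2 * of_real pi * \<i> * of_real (par_a A) / of_real (par_b A)) * of_real t * f t)"

definition A_translation :: "param_set \<Rightarrow> real \<Rightarrow> (real \<Rightarrow> complex) \<Rightarrow> real \<Rightarrow> complex" where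
  "A_translation A x f =
     (\<lambda>t. exp (- (2 * of_real pi * \<i> * of_real (par_a A) / of_real (par_b A)) * of_real x * of_real (t - x))
          * f (t - x))"

end

theory Submission
  imports Defs
begin

text \<open>Write \<open>k\<close> for 2 pi i a / b. Differentiating the phase exp(-k x (t - x))
  produces the extra term -k x f(t - x), and this is exactly what turns the multiplier k t of
  \<open>B_op\<close> into k (t - x), the multiplier seen after shifting. The calculus is in
  \<open>has_vector_derivative_modulated_shift\<close>; of the Schwartz property only
  differentiability of \<open>f\<close> enters.\<close>

lemma schwartz_space_differentiable:
  assumes "f \<in> schwartz_space"
  shows "f differentiable (at t)"
proof -
  have "(vderiv ^^ 0) f differentiable (at t)"
    using assms unfolding schwartz_space_def by blast
  then show ?thesis by simp
qed

text \<open>Product rule for phase times shifted function, with the phase factored out so that it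
  can be compared with a translate directly.\<close>

lemma has_vector_derivative_modulated_shift:
  fixes k :: complex and f :: "real \<Rightarrow> complex"
  assumes "f differentiable (at (t - x))"
  shows "((\<lambda>t. exp (- k * of_real x * of_real (t - x)) * f (t - x)) has_vector_derivative
           exp (- k * of_real x * of_real (t - x)) * (vderiv f (t - x) - k * of_real x * f (t - x)))
         (at t)"
proof -
  have shift: "((\<lambda>t. t - x) has_vector_derivative 1) (at t)"
    by (auto intro!: derivative_eq_intros)
  have "(f has_vector_derivative vderiv f (t - x)) (at (t - x))"
    using assms by (simp add: vderiv_def vector_derivative_works)
  then have f': "((\<lambda>t. f (t - x)) has_vector_derivative vderiv f (t - x)) (at t)"
    using vector_diff_chain_at[OF shift] by (simp add: o_def)
  \<comment> \<open>The phase is differentiated as an entire function of \<open>z\<close>, then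
    restricted to the real line.\<close>
  have "((\<lambda>z. exp (- k * of_real x * (z - of_real x))) has_field_derivative
          exp (- k * of_real x * (of_real t - of_real x)) * (- k * of_real x)) (at (of_real t))"
    by (auto intro!: derivative_eq_intros)
  then have e': "((\<lambda>t. exp (- k * of_real x * of_real (t - x))) has_vector_derivative
          exp (- k * of_real x * of_real (t - x)) * (- k * of_real x)) (at t)"
    by (auto dest: has_vector_derivative_real_field)
  show ?thesis
    using has_vector_derivative_mult[OF e' f'] by (simp add: algebra_simps)
qed

theorem mainTheorem17:
  fixes A :: param_set and x :: real and f :: "real \<Rightarrow> complex"
  assumes "admissible A"
    and "f \<in> schwartz_space"
  shows "B_op A (A_translation A x f) = A_translation A x (B_op A f)"
proof
  fix t
  define k :: complex where "k = 2 * of_real pi * \<i> * of_real (par_a A) / of_real (par_b A)"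
  have "vderiv (A_translation A x f) t =
      exp (- k * of_real x * of_real (t - x)) * (vderiv f (t - x) - k * of_real x * f (t - x))"
    \<comment> \<open>Only this instance is unfolded: \<open>vderiv f\<close> on the right must stay
      folded to match the lemma.\<close>
    unfolding vderiv_def[of "A_translation A x f"]
    unfolding A_translation_def k_def[symmetric]
    by (intro vector_derivative_at has_vector_derivative_modulated_shift
        schwartz_space_differentiable assms(2))
  \<comment> \<open>With the common phase factored out, what remains is k t - k x = k (t -
    x).\<close>
  then show "B_op A (A_translation A x f) t = A_translation A x (B_op A f) t"
    unfolding B_op_def A_translation_def k_def[symmetric] by (simp add: algebra_simps)
qed

end
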